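(* Let $n\ge 1$. (1) A set $S\subseteq\mathbb{Z}^n$ is a box of integers if and only if it is both multimodular and L$^\natural$-convex. (2) A function $f:\mathbb{Z}^n\to\mathbb{R}\cup\{+\infty\}$ is separable convex if and only if it is both multimodular and L$^\natural$-convex.
   Context: Notation: $x\vee y$, $x\wedge y$ are componentwise max/min; $\lceil\cdot\rceil,\lfloor\cdot\rfloor$ act componentwise. For $f:\mathbb{Z}^n\to\mathbb{R}\cup\{+\infty\}$, $\operatorname{dom} f=\{x: f(x)<+\infty\}$, always assumed nonempty. The indicator $\delta_S$ of $S$ is $0$ on $S$ and $+\infty$ off $S$. A function $h$ on $\mathbb{Z}^m$ is submodular if $h(u)+h(v)\ge h(u\vee v)+h(u\wedge v)$ for all $u,v$. A box of integers is $[a,b]_{\mathbb{Z}}=\{x\in\mathbb{Z}^n: a_i\le x_i\le b_i\ \forall i\}$ with $a\in(\mathbb{Z}\cup\{-\infty\})^n$, $b\in(\mathbb{Z}\cup\{+\infty\})^n$, $a\le b$. A function $f$ is separable convex if $f(x)=\sum_{i=1}^n\varphi_i(x_i)$ with univariate $\varphi_i:\mathbb{Z}\to\mathbb{R}\cup\{+\infty\}$ whose effective domains are (nonempty) intervals of integers and which satisfy $\varphi_i(t-1)+\varphi_i(t+1)\ge 2\varphi_i(t)$ for all $t\in\mathbb{Z}$. A function $f$ is multimodular if $\tilde f(x_0,x)=f(x_1-x_0,x_2-x_1,\dots,x_n-x_{n-1})$ on $\mathbb{Z}^{n+1}$ is submodular; a nonempty set $S$ is multimodular if $\delta_S$ is.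 A function $f$ is L$^\natural$-convex if $f(x)+f(y)\ge f(\lceil (x+y)/2\rceil)+f(\lfloor (x+y)/2\rfloor)$ for all $x,y\in\mathbb{Z}^n$. A nonempty set $S$ is L$^\natural$-convex if $x,y\in S$ implies $\lceil (x+y)/2\rceil,\lfloor (x+y)/2\rfloor\in S$. *)

theory Defs
  imports Complex_Main "HOL-Library.FuncSet" "HOL-Library.Extended" "HOL-Library.Extended_Real"
begin

no_notation Pinf (\<open>\<infinity>\<close>) and Minf (\<open>-\<infinity>\<close>)

text \<open>
  Integer vectors with coordinates indexed by a set \<open>I\<close> of naturals are the extensional functions
  on \<open>I\<close>. Vectors of the \<open>n\<close>-dimensional lattice have coordinates \<open>1, \<dots>, n\<close>; the auxiliary
  functions in the definition of multimodularity live on coordinates \<open>0, 1, \<dots>, n\<close>.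
\<close>

definition int_vecs :: "nat set \<Rightarrow> (nat \<Rightarrow> int) set" where
  "int_vecs I = I \<rightarrow>\<^sub>E UNIV"

abbreviation Zn :: "nat \<Rightarrow> (nat \<Rightarrow> int) set" where
  "Zn n \<equiv> int_vecs {1..n}"

definition vec_max :: "nat set \<Rightarrow> (nat \<Rightarrow> int) \<Rightarrow> (nat \<Rightarrow> int) \<Rightarrow> nat \<Rightarrow> int" where
  "vec_max I u v = (\<lambda>i\<in>I. max (u i) (v i))"

definition vec_min :: "nat set \<Rightarrow> (nat \<Rightarrow> int) \<Rightarrow> (nat \<Rightarrow> int) \<Rightarrow> nat \<Rightarrow> int" where
  "vec_min I u v = (\<lambda>i\<in>I. min (u i) (v i))"

definition mid_up :: "nat set \<Rightarrow> (nat \<Rightarrow> int) \<Rightarrow> (nat \<Rightarrow> int) \<Rightarrow> nat \<Rightarrow> int" where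
  "mid_up I x y = (\<lambda>i\<in>I. \<lceil>(real_of_int (x i) + real_of_int (y i)) / 2\<rceil>)"

definition mid_down :: "nat set \<Rightarrow> (nat \<Rightarrow> int) \<Rightarrow> (nat \<Rightarrow> int) \<Rightarrow> nat \<Rightarrow> int" where
  "mid_down I x y = (\<lambda>i\<in>I. \<lfloor>(real_of_int (x i) + real_of_int (y i)) / 2\<rfloor>)"

text \<open>
  Functions with values in the reals or plus infinity are \<open>ereal\<close>-valued functions avoiding
  \<open>-\<infinity>\<close> on the lattice; their values outside the lattice are irrelevant.
\<close>

definition eff_dom :: "'a set \<Rightarrow> ('a \<Rightarrow> ereal) \<Rightarrow> 'a set" where
  "eff_dom X f = {x \<in> X. f x < \<infinity>}"

definition proper_on :: "'a set \<Rightarrow> ('a \<Rightarrow> ereal) \<Rightarrow> bool" where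
  "proper_on X f \<longleftrightarrow> (\<forall>x\<in>X. f x \<noteq> -\<infinity>) \<and> eff_dom X f \<noteq> {}"

definition delta :: "'a set \<Rightarrow> 'a \<Rightarrow> ereal" where
  "delta S x = (if x \<in> S then 0 else \<infinity>)"

definition submodular :: "nat set \<Rightarrow> ((nat \<Rightarrow> int) \<Rightarrow> ereal) \<Rightarrow> bool" where
  "submodular I h \<longleftrightarrow>
    (\<forall>u\<in>int_vecs I. \<forall>v\<in>int_vecs I. h u + h v \<ge> h (vec_max I u v) + h (vec_min I u v))"

definition tilde :: "nat \<Rightarrow> ((nat \<Rightarrow> int) \<Rightarrow> ereal) \<Rightarrow> (nat \<Rightarrow> int) \<Rightarrow> ereal" where
  "tilde n f x = f (\<lambda>i\<in>{1..n}. x i - x (i - 1))"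

definition multimodular :: "nat \<Rightarrow> ((nat \<Rightarrow> int) \<Rightarrow> ereal) \<Rightarrow> bool" where
  "multimodular n f \<longleftrightarrow> submodular {0..n} (tilde n f)"

definition multimodular_set :: "nat \<Rightarrow> (nat \<Rightarrow> int) set \<Rightarrow> bool" where
  "multimodular_set n S \<longleftrightarrow> S \<noteq> {} \<and> multimodular n (delta S)"

definition Lnat_convex :: "nat \<Rightarrow> ((nat \<Rightarrow> int) \<Rightarrow> ereal) \<Rightarrow> bool" where
  "Lnat_convex n f \<longleftrightarrow>
    (\<forall>x\<in>Zn n. \<forall>y\<in>Zn n. f x + f y \<ge> f (mid_up {1..n} x y) + f (mid_down {1..n} x y))"

definition Lnat_convex_set :: "nat \<Rightarrow> (nat \<Rightarrow> int) set \<Rightarrow> bool" where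
  "Lnat_convex_set n S \<longleftrightarrow>
    S \<noteq> {} \<and> (\<forall>x\<in>S. \<forall>y\<in>S. mid_up {1..n} x y \<in> S \<and> mid_down {1..n} x y \<in> S)"

text \<open>
  In \<open>int extended\<close> the elements \<open>Minf\<close> and \<open>Pinf\<close> are minus and plus infinity. A lower bound is an
  integer or minus infinity, an upper bound an integer or plus infinity; since the lower bound
  does not exceed the upper one, intervals and boxes are nonempty.
\<close>

definition bounds :: "int extended \<Rightarrow> int extended \<Rightarrow> bool" where
  "bounds a b \<longleftrightarrow> a \<noteq> Pinf \<and> b \<noteq> Minf \<and> a \<le> b"

definition int_interval :: "int set \<Rightarrow> bool" where
  "int_interval D \<longleftrightarrow> (\<exists>a b. bounds a b \<and> D = {t. a \<le> Fin t \<and> Fin t \<le> b})"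

definition int_box :: "nat \<Rightarrow> (nat \<Rightarrow> int) set \<Rightarrow> bool" where
  "int_box n S \<longleftrightarrow>
    (\<exists>a b. (\<forall>i\<in>{1..n}. bounds (a i) (b i)) \<and>
      S = {x \<in> Zn n. \<forall>i\<in>{1..n}. a i \<le> Fin (x i) \<and> Fin (x i) \<le> b i})"

definition univ_convex :: "(int \<Rightarrow> ereal) \<Rightarrow> bool" where
  "univ_convex \<phi> \<longleftrightarrow>
    (\<forall>t. \<phi> t \<noteq> -\<infinity>) \<and> int_interval (eff_dom UNIV \<phi>) \<and>
    (\<forall>t. \<phi> (t - 1) + \<phi> (t + 1) \<ge> 2 * \<phi> t)"

definition separable_convex :: "nat \<Rightarrow> ((nat \<Rightarrow> int) \<Rightarrow> ereal) \<Rightarrow> bool" where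
  "separable_convex n f \<longleftrightarrow>
    (\<exists>\<phi>. (\<forall>i\<in>{1..n}. univ_convex (\<phi> i)) \<and> (\<forall>x\<in>Zn n. f x = (\<Sum>i=1..n. \<phi> i (x i))))"

end

theory Submission
  imports Defs
begin

text \<open>
  Iterated midpoints show that an L-natural-convex set is closed under componentwise max and min.
  If it is also multimodular, then for \<open>x \<le> y\<close> in it the prefix sums can be clipped so that only one
  coordinate of \<open>x\<close> moves towards \<open>y\<close>; hence the set is a box. For functions, discrete midpoint convexity gives
  \<open>f (z + e\<^sub>i) + f (z + e\<^sub>j) \<ge> f z + f (z + e\<^sub>i + e\<^sub>j)\<close> and multimodularity the reverse inequality.
  So mixed second differences vanish on the effective domain, which is a box, and \<open>f\<close> is a sum of
  univariate functions. Conversely, both kinds of inequality hold term by term, since each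
  coordinate pair is replaced by a pair with the same sum lying between the original values.
\<close>

text \<open>Keeps the index set \<open>{1..n}\<close> from being rewritten to \<open>{Suc 0..n}\<close>.\<close>

declare One_nat_def [simp del]

section \<open>Integer vectors and rounded midpoints\<close>

lemma int_vecs_eqI:
  "x \<in> int_vecs I \<Longrightarrow> y \<in> int_vecs I \<Longrightarrow> (\<And>i. i \<in> I \<Longrightarrow> x i = y i) \<Longrightarrow> x = y"
  unfolding int_vecs_def by (rule PiE_ext) auto

lemma restrict_in_int_vecs [simp]: "restrict g I \<in> int_vecs I"
  by (auto simp: int_vecs_def)

lemma int_vecs_fun_upd [simp]: "x \<in> int_vecs I \<Longrightarrow> i \<in> I \<Longrightarrow> x(i := t) \<in> int_vecs I"
  by (auto simp: int_vecs_def PiE_def extensional_def)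

lemma vec_max_in [simp]: "vec_max I u v \<in> int_vecs I"
  and vec_min_in [simp]: "vec_min I u v \<in> int_vecs I"
  by (simp_all add: vec_max_def vec_min_def)

text \<open>The ceiling is minus the floor of the negated argument. Stating midpoints with
  \<open>div\<close> lets \<open>linarith\<close> settle all later rounding facts.\<close>

lemma ceiling_half: "\<lceil>(real_of_int a + real_of_int b) / 2\<rceil> = (a + b + 1) div 2"
proof -
  have "\<lceil>(real_of_int a + real_of_int b) / 2\<rceil> = - \<lfloor>real_of_int (- a - b) / real_of_int 2\<rfloor>"
    by (simp add: ceiling_def add_divide_distrib diff_divide_distrib)
  also have "\<dots> = (a + b + 1) div 2"
    unfolding floor_divide_of_int_eq by linarith
  finally show ?thesis .
qed

lemma floor_half: "\<lfloor>(real_of_int a + real_of_int b) / 2\<rfloor> = (a + b) div 2"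
  using floor_divide_of_int_eq[of "a + b" 2] by simp

lemma mid_up_eq: "mid_up I x y = (\<lambda>i\<in>I. (x i + y i + 1) div 2)"
  by (simp add: mid_up_def ceiling_half)

lemma mid_down_eq: "mid_down I x y = (\<lambda>i\<in>I. (x i + y i) div 2)"
  by (simp add: mid_down_def floor_half)

lemma mid_up_in [simp]: "mid_up I x y \<in> int_vecs I"
  and mid_down_in [simp]: "mid_down I x y \<in> int_vecs I"
  by (simp_all add: mid_up_eq mid_down_eq)

section \<open>Increments, prefix sums and multimodularity\<close>

text \<open>This is the vector at which \<open>tilde n\<close> evaluates its function. Only the
  values of \<open>g\<close> at 0 to \<open>n\<close> matter, so \<open>g\<close> may be any
  function on the naturals.\<close>

definition increments :: "nat \<Rightarrow> (nat \<Rightarrow> int) \<Rightarrow> nat \<Rightarrow> int" where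
  "increments n g = (\<lambda>i\<in>{1..n}. g i - g (i - 1))"

text \<open>A right inverse of \<open>increments n\<close> on the lattice, normalised to 0 at index
  0.\<close>

definition psum :: "(nat \<Rightarrow> int) \<Rightarrow> nat \<Rightarrow> int" where
  "psum x k = (\<Sum>j=1..k. x j)"

lemma increments_in [simp]: "increments n g \<in> Zn n"
  by (simp add: increments_def)

lemma increments_cong: "(\<And>k. k \<le> n \<Longrightarrow> g k = h k) \<Longrightarrow> increments n g = increments n h"
  by (auto simp: increments_def fun_eq_iff)

lemma psum_step: "1 \<le> k \<Longrightarrow> psum x k = psum x (k - 1) + x k"
  by (cases k) (auto simp: psum_def)

lemma increments_psum: "x \<in> Zn n \<Longrightarrow> increments n (psum x) = x"
  by (rule int_vecs_eqI[of _ "{1..n}"]) (auto simp: increments_def psum_step)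

lemma increments_shift [simp]: "increments n (\<lambda>k. g k + c) = increments n g" "increments n (\<lambda>k. g k - c) = increments n g"
  by (auto simp: increments_def)

text \<open>Restricting \<open>g\<close> and \<open>h\<close> to \<open>{0..n}\<close> leaves all
  four increment vectors unchanged, so extensional arguments can be traded for arbitrary
  functions.\<close>

lemma multimodular_iff:
  "multimodular n f \<longleftrightarrow>
    (\<forall>g h. f (increments n (\<lambda>k. max (g k) (h k))) + f (increments n (\<lambda>k. min (g k) (h k)))
      \<le> f (increments n g) + f (increments n h))" (is "?L \<longleftrightarrow> ?R")
proof
  assume L: ?L
  show ?R
  proof (intro allI)
    fix g h :: "nat \<Rightarrow> int"
    let ?g = "restrict g {0..n}" and ?h = "restrict h {0..n}"
    have "tilde n f ?g + tilde n f ?h \<ge>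
        tilde n f (vec_max {0..n} ?g ?h) + tilde n f (vec_min {0..n} ?g ?h)"
      using L by (simp add: multimodular_def submodular_def)
    moreover have "increments n ?g = increments n g" "increments n ?h = increments n h"
      "increments n (vec_max {0..n} ?g ?h) = increments n (\<lambda>k. max (g k) (h k))"
      "increments n (vec_min {0..n} ?g ?h) = increments n (\<lambda>k. min (g k) (h k))"
      by (auto intro!: increments_cong simp: vec_max_def vec_min_def)
    ultimately show "f (increments n (\<lambda>k. max (g k) (h k))) + f (increments n (\<lambda>k. min (g k) (h k)))
      \<le> f (increments n g) + f (increments n h)"
      unfolding tilde_def increments_def[symmetric] by simp
  qed
next
  assume R: ?R
  have "increments n (vec_max {0..n} u v) = increments n (\<lambda>k. max (u k) (v k))"
    "increments n (vec_min {0..n} u v) = increments n (\<lambda>k. min (u k) (v k))" for u v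
    by (auto intro!: increments_cong simp: vec_max_def vec_min_def)
  then show ?L
    using R unfolding multimodular_def submodular_def tilde_def increments_def[symmetric] by simp
qed

section \<open>Closure properties of effective domains\<close>

text \<open>Set form of multimodularity: the preimage of \<open>S\<close> under
  \<open>increments n\<close> is a sublattice.\<close>

definition diff_lattice :: "nat \<Rightarrow> (nat \<Rightarrow> int) set \<Rightarrow> bool" where
  "diff_lattice n S \<longleftrightarrow> (\<forall>g h. increments n g \<in> S \<longrightarrow> increments n h \<in> S \<longrightarrow>
    increments n (\<lambda>k. max (g k) (h k)) \<in> S \<and> increments n (\<lambda>k. min (g k) (h k)) \<in> S)"

text \<open>Turns either defining inequality into a closure property of the effective
  domain.\<close>

lemma ereal_add_less_PInf:
  fixes a b c d :: ereal
  assumes "a + b \<le> c + d" "c < \<infinity>" "d < \<infinity>" "a \<noteq> -\<infinity>" "b \<noteq> -\<infinity>"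
  shows "a < \<infinity>" "b < \<infinity>"
  using assms by (cases a; cases b; cases c; cases d; simp)+

lemma diff_lattice_eff_dom:
  assumes "proper_on (Zn n) f" "multimodular n f"
  shows "diff_lattice n (eff_dom (Zn n) f)"
proof -
  have "f (increments n (\<lambda>k. max (g k) (h k))) < \<infinity> \<and> f (increments n (\<lambda>k. min (g k) (h k))) < \<infinity>"
    if "f (increments n g) < \<infinity>" "f (increments n h) < \<infinity>" for g h
  proof -
    have *: "f (increments n (\<lambda>k. max (g k) (h k))) + f (increments n (\<lambda>k. min (g k) (h k)))
      \<le> f (increments n g) + f (increments n h)"
      using assms(2) unfolding multimodular_iff by blast
    show ?thesis
      using ereal_add_less_PInf[OF * that] assms(1) by (simp add: proper_on_def)
  qed
  then show ?thesis
    unfolding diff_lattice_def eff_dom_def by simp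
qed

lemma Lnat_convex_set_eff_dom:
  assumes "proper_on (Zn n) f" "Lnat_convex n f"
  shows "Lnat_convex_set n (eff_dom (Zn n) f)"
proof -
  have "f (mid_up {1..n} x y) < \<infinity> \<and> f (mid_down {1..n} x y) < \<infinity>"
    if "x \<in> Zn n" "y \<in> Zn n" "f x < \<infinity>" "f y < \<infinity>" for x y
  proof -
    have *: "f (mid_up {1..n} x y) + f (mid_down {1..n} x y) \<le> f x + f y"
      using assms(2) that unfolding Lnat_convex_def by blast
    show ?thesis
      using ereal_add_less_PInf[OF * that(3,4)] assms(1) by (simp add: proper_on_def)
  qed
  then show ?thesis
    using assms(1) unfolding Lnat_convex_set_def proper_on_def eff_dom_def by simp
qed

lemma diff_lattice_multimodular_delta: "diff_lattice n S \<Longrightarrow> multimodular n (delta S)"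
  unfolding multimodular_iff diff_lattice_def delta_def by auto

text \<open>A set of lattice points is the effective domain of its own indicator, so the result for
  functions applies.\<close>

lemma multimodular_set_diff_lattice:
  assumes "S \<subseteq> Zn n" "multimodular_set n S"
  shows "diff_lattice n S"
proof -
  have "eff_dom (Zn n) (delta S) = S"
    using assms(1) by (auto simp: eff_dom_def delta_def split: if_splits)
  moreover from this have "proper_on (Zn n) (delta S)"
    using assms(2) by (auto simp: proper_on_def multimodular_set_def delta_def)
  ultimately show ?thesis
    using diff_lattice_eff_dom[of n "delta S"] assms(2) by (simp add: multimodular_set_def)
qed

section \<open>Closure under maxima by iterated midpoints\<close>

context
  fixes n :: nat and S :: "(nat \<Rightarrow> int) set"
  assumes S: "S \<subseteq> Zn n"
    and mid_up: "\<And>x y. x \<in> S \<Longrightarrow> y \<in> S \<Longrightarrow> mid_up {1..n} x y \<in> S"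
begin

text \<open>Replacing \<open>y\<close> by the midpoint of \<open>x\<close> and \<open>y\<close> rounded up halves the differences without
  changing where they are positive, until they all are 0 or 1.\<close>

lemma mid_up_closed_step:
  assumes "x \<in> S" "y \<in> S"
  shows "(\<lambda>i\<in>{1..n}. x i + of_bool (x i < y i)) \<in> S"
  using assms(2)
proof (induction "\<Sum>i=1..n. nat \<bar>y i - x i\<bar>" arbitrary: y rule: less_induct)
  case less
  show ?case
  proof (cases "\<forall>i\<in>{1..n}. y i - x i \<in> {0, 1}")
    case True
    have "x i + of_bool (x i < y i) = y i" if "i \<in> {1..n}" for i
      using bspec[OF True that] by auto
    then have "(\<lambda>i\<in>{1..n}. x i + of_bool (x i < y i)) = y"
      using less.prems S by (intro int_vecs_eqI[of _ "{1..n}"]) auto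
    then show ?thesis using less.prems by simp
  next
    case False
    \<comment> \<open>The index must avoid difference 1 as well as 0: rounding up fixes 1, while
      every other nonzero difference shrinks in absolute value.\<close>
    then obtain j where j: "j \<in> {1..n}" "y j - x j \<noteq> 0" "y j - x j \<noteq> 1"
      by auto
    let ?z = "mid_up {1..n} x y"
    have z: "?z i = (x i + y i + 1) div 2" if "i \<in> {1..n}" for i
      using that by (simp add: mid_up_eq)
    have "(\<Sum>i=1..n. nat \<bar>?z i - x i\<bar>) < (\<Sum>i=1..n. nat \<bar>y i - x i\<bar>)"
    proof (rule sum_strict_mono_ex1)
      show "\<forall>i\<in>{1..n}. nat \<bar>?z i - x i\<bar> \<le> nat \<bar>y i - x i\<bar>"
      proof
        fix i assume "i \<in> {1..n}"
        from z[OF this] show "nat \<bar>?z i - x i\<bar> \<le> nat \<bar>y i - x i\<bar>" by linarith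
      qed
      show "\<exists>i\<in>{1..n}. nat \<bar>?z i - x i\<bar> < nat \<bar>y i - x i\<bar>"
        using z[OF j(1)] j by (intro bexI[of _ j]) linarith+
    qed simp
    moreover have "?z \<in> S"
      using mid_up assms(1) less.prems by blast
    ultimately have "(\<lambda>i\<in>{1..n}. x i + of_bool (x i < ?z i)) \<in> S"
      by (rule less.hyps)
    moreover have "x i < ?z i \<longleftrightarrow> x i < y i" if "i \<in> {1..n}" for i
      using z[OF that] by linarith
    then have "(\<lambda>i\<in>{1..n}. x i + of_bool (x i < ?z i)) = (\<lambda>i\<in>{1..n}. x i + of_bool (x i < y i))"
      by (intro restrict_ext) simp
    ultimately show ?thesis by simp
  qed
qed

text \<open>Repeating \<open>mid_up_closed_step\<close> raises \<open>x\<close> by one wherever it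
  is below \<open>y\<close>. This keeps the maximum and lowers the total deficit, so the process
  ends at the maximum.\<close>

lemma mid_up_closed_vec_max:
  assumes "x \<in> S" "y \<in> S"
  shows "vec_max {1..n} x y \<in> S"
  using assms(1)
proof (induction "\<Sum>i=1..n. nat (y i - x i)" arbitrary: x rule: less_induct)
  case less
  show ?case
  proof (cases "\<forall>i\<in>{1..n}. y i \<le> x i")
    case True
    then have "vec_max {1..n} x y = x"
      using less.prems S by (intro int_vecs_eqI[of _ "{1..n}"]) (auto simp: vec_max_def)
    then show ?thesis using less.prems by simp
  next
    case False
    then obtain j where j: "j \<in> {1..n}" "x j < y j"
      by force
    let ?z = "\<lambda>i\<in>{1..n}. x i + of_bool (x i < y i)"
    have "(\<Sum>i=1..n. nat (y i - ?z i)) < (\<Sum>i=1..n. nat (y i - x i))"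
      using j by (intro sum_strict_mono_ex1) (auto intro!: bexI[of _ j])
    moreover have "?z \<in> S"
      using mid_up_closed_step less.prems assms(2) by blast
    ultimately have "vec_max {1..n} ?z y \<in> S"
      by (rule less.hyps)
    moreover have "vec_max {1..n} ?z y = vec_max {1..n} x y"
      unfolding vec_max_def by (intro restrict_ext) auto
    ultimately show ?thesis by simp
  qed
qed

end

section \<open>Moving a single coordinate\<close>

text \<open>Raising all prefix sums from index \<open>i\<close> on by \<open>t\<close> affects only
  the \<open>i\<close>-th increment.\<close>

lemma increments_psum_upd:
  assumes "x \<in> Zn n" "i \<in> {1..n}"
  shows "increments n (\<lambda>k. psum x k + (if i \<le> k then t else 0)) = x(i := x i + t)"
proof (rule int_vecs_eqI[of _ "{1..n}"])
  fix k assume k: "k \<in> {1..n}"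
  then show "increments n (\<lambda>k. psum x k + (if i \<le> k then t else 0)) k = (x(i := x i + t)) k"
    using assms psum_step[of k x] by (auto simp: increments_def)
qed (use assms in auto)

text \<open>The prefix sums of the result are those of \<open>y\<close>, suitably shifted, clipped to the range
  between those of \<open>x\<close> and those of \<open>x\<close> plus \<open>t\<close>.\<close>

lemma diff_lattice_upd:
  assumes S: "diff_lattice n S" "S \<subseteq> Zn n" and xy: "x \<in> S" "y \<in> S"
    and le: "\<And>k. k \<in> {1..n} \<Longrightarrow> x k \<le> y k"
    and i: "i \<in> {1..n}" and t: "0 \<le> t" "t \<le> y i - x i"
  shows "x(i := x i + t) \<in> S"
proof -
  let ?P = "psum x" and ?Q = "psum y"
  \<comment> \<open>With this shift the prefix sum of \<open>y\<close> meets the upper clipping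
    bound \<open>?P i + t\<close> exactly at index \<open>i\<close>.\<close>
  define c where "c = ?Q i - ?P i - t"
  have P: "increments n ?P = x" and Q: "increments n ?Q = y"
    using xy S by (auto intro: increments_psum)
  have "increments n (\<lambda>k. max (?P k) (?Q k - c)) \<in> S"
    using S(1) xy P Q increments_shift(2)[of n ?Q c] unfolding diff_lattice_def by metis
  then have "increments n (\<lambda>k. min (max (?P k) (?Q k - c)) (?P k + t)) \<in> S"
    using S(1) xy P increments_shift(1)[of n ?P t] unfolding diff_lattice_def by metis
  moreover have "increments n (\<lambda>k. min (max (?P k) (?Q k - c)) (?P k + t))
      = increments n (\<lambda>k. ?P k + (if i \<le> k then t else 0))"
  proof (rule increments_cong)
    fix k assume k: "k \<le> n"
    \<comment> \<open>Since \<open>x\<close> is below \<open>y\<close>, the gap between the prefix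
      sums is nondecreasing. It grows by at least \<open>t\<close> from \<open>i - 1\<close> to
      \<open>i\<close>, so after the shift it is at most 0 before \<open>i\<close> and at least
      \<open>t\<close> from \<open>i\<close> on.\<close>
    have mono: "?Q l - ?P l \<le> ?Q m - ?P m" if "l \<le> m" "m \<le> n" for l m
      unfolding psum_def sum_subtractf[symmetric]
      using that le by (intro sum_mono2) auto
    show "min (max (?P k) (?Q k - c)) (?P k + t) = ?P k + (if i \<le> k then t else 0)"
    proof (cases "i \<le> k")
      case True
      then show ?thesis using mono[of i k] k t by (simp add: c_def)
    next
      case False
      then have "?Q k - ?P k \<le> ?Q (i - 1) - ?P (i - 1)"
        using mono[of k "i - 1"] i by simp
      then show ?thesis
        using False t i psum_step[of i x] psum_step[of i y] by (simp add: c_def)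
    qed
  qed
  ultimately show ?thesis
    using increments_psum_upd[of x n i t] xy S i by auto
qed

text \<open>Reflection exchanges max with min and rounding up with rounding down, so downward moves
  follow from upward ones.\<close>

definition neg :: "nat \<Rightarrow> (nat \<Rightarrow> int) \<Rightarrow> nat \<Rightarrow> int" where
  "neg n x = (\<lambda>i\<in>{1..n}. - x i)"

lemma neg_in [simp]: "neg n x \<in> Zn n"
  by (simp add: neg_def)

lemma neg_neg [simp]: "x \<in> Zn n \<Longrightarrow> neg n (neg n x) = x"
  by (rule int_vecs_eqI[of _ "{1..n}"]) (auto simp: neg_def)

lemma neg_mid: "neg n (mid_up {1..n} x y) = mid_down {1..n} (neg n x) (neg n y)"
  "neg n (mid_down {1..n} x y) = mid_up {1..n} (neg n x) (neg n y)"
  by (auto simp: neg_def mid_up_eq mid_down_eq intro!: restrict_ext; linarith)+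

lemma neg_increments: "neg n (increments n g) = increments n (\<lambda>k. - g k)"
  by (auto simp: neg_def increments_def)

lemma diff_lattice_neg: "diff_lattice n S \<Longrightarrow> diff_lattice n {x \<in> Zn n. neg n x \<in> S}"
  by (auto simp: diff_lattice_def neg_increments minus_max_eq_min minus_min_eq_max)

lemma Lnat_convex_set_neg:
  assumes "Lnat_convex_set n S" "S \<subseteq> Zn n"
  shows "Lnat_convex_set n {x \<in> Zn n. neg n x \<in> S}"
proof -
  obtain x where "x \<in> S" using assms by (auto simp: Lnat_convex_set_def)
  then have "neg n x \<in> {x \<in> Zn n. neg n x \<in> S}" using assms by auto
  then show ?thesis
    using assms unfolding Lnat_convex_set_def by (auto simp: neg_mid)
qed

text \<open>The point \<open>y\<close> need not dominate \<open>x\<close>, but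
  \<open>vec_max {1..n} x y\<close> does, and it agrees with \<open>y\<close> at
  \<open>i\<close>.\<close>

lemma exchange_up:
  assumes S: "diff_lattice n S" "Lnat_convex_set n S" "S \<subseteq> Zn n"
    and xy: "x \<in> S" "y \<in> S" and i: "i \<in> {1..n}" and t: "x i \<le> t" "t \<le> y i"
  shows "x(i := t) \<in> S"
proof -
  have "vec_max {1..n} x y \<in> S"
    using S xy by (intro mid_up_closed_vec_max) (auto simp: Lnat_convex_set_def)
  from diff_lattice_upd[OF S(1,3) xy(1) this _ i, of "t - x i"]
  show ?thesis using i t by (simp add: vec_max_def)
qed

text \<open>The upward case is \<open>exchange_up\<close>; the downward case is the same lemma for
  the reflected set.\<close>

lemma exchange:
  assumes S: "diff_lattice n S" "Lnat_convex_set n S" "S \<subseteq> Zn n"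
    and xy: "x \<in> S" "y \<in> S" and i: "i \<in> {1..n}"
    and t: "x i \<le> t \<and> t \<le> y i \<or> y i \<le> t \<and> t \<le> x i"
  shows "x(i := t) \<in> S"
  using t
proof
  assume "x i \<le> t \<and> t \<le> y i"
  then show ?thesis using exchange_up[OF S xy i] by simp
next
  assume t: "y i \<le> t \<and> t \<le> x i"
  have xy': "x \<in> Zn n" "y \<in> Zn n" using xy S by auto
  have "(neg n x)(i := -t) \<in> {x \<in> Zn n. neg n x \<in> S}"
    by (rule exchange_up[OF diff_lattice_neg[OF S(1)] Lnat_convex_set_neg[OF S(2,3)], of _ "neg n y"])
      (use xy xy' i t in simp_all, simp_all add: neg_def)
  moreover have "neg n ((neg n x)(i := -t)) = x(i := t)"
    using xy' i by (intro int_vecs_eqI[of _ "{1..n}"]) (auto simp: neg_def)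
  ultimately show ?thesis by simp
qed

section \<open>Integer intervals and boxes\<close>

lemma int_intervalI:
  assumes ne: "D \<noteq> {}"
    and conv: "\<And>a b t. a \<in> D \<Longrightarrow> b \<in> D \<Longrightarrow> a \<le> t \<Longrightarrow> t \<le> b \<Longrightarrow> t \<in> D"
  shows "int_interval D"
proof -
  obtain d where d: "d \<in> D" using ne by auto
  define a where "a = (if bdd_below D then Fin (Inf D) else Minf)"
  define b where "b = (if bdd_above D then Fin (Sup D) else Pinf)"
  have lo: "a \<le> Fin t" if "t \<in> D" for t
    using that by (auto simp: a_def intro: cInf_lower)
  have hi: "Fin t \<le> b" if "t \<in> D" for t
    using that by (auto simp: b_def intro: cSup_upper)
  have lo': "\<exists>s\<in>D. s \<le> t" if "a \<le> Fin t" for t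
  proof (cases "bdd_below D")
    case True
    \<comment> \<open>Adding 1 gives the strict inequality that \<open>cInf_lessD\<close> asks for;
      over the integers \<open>s < t + 1\<close> is \<open>s \<le> t\<close> again.\<close>
    then have "Inf D < t + 1" using that by (simp add: a_def)
    then obtain s where "s \<in> D" "s < t + 1" using cInf_lessD[OF ne] by blast
    then show ?thesis by (intro bexI[of _ s]) auto
  next
    case False
    then show ?thesis unfolding bdd_below_def by (meson linorder_le_cases)
  qed
  have hi': "\<exists>s\<in>D. t \<le> s" if "Fin t \<le> b" for t
  proof (cases "bdd_above D")
    case True
    then have "t - 1 < Sup D" using that by (simp add: b_def)
    then obtain s where "s \<in> D" "t - 1 < s" using less_cSupD[OF ne] by blast
    then show ?thesis by (intro bexI[of _ s]) auto
  next
    case False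
    then show ?thesis unfolding bdd_above_def by (meson linorder_le_cases)
  qed
  have "bounds a b"
    using order_trans[OF lo[OF d] hi[OF d]] by (auto simp: bounds_def a_def b_def)
  moreover have "D = {t. a \<le> Fin t \<and> Fin t \<le> b}"
    using lo hi lo' hi' conv by blast
  ultimately show ?thesis unfolding int_interval_def by blast
qed

lemma int_interval_convex:
  "int_interval D \<Longrightarrow> a \<in> D \<Longrightarrow> b \<in> D \<Longrightarrow> a \<le> t \<Longrightarrow> t \<le> b \<Longrightarrow> t \<in> D"
  by (auto simp: int_interval_def) (meson less_eq_extended.simps(1) order_trans)+

lemma int_interval_between:
  assumes "int_interval D" "a \<in> D" "b \<in> D" "min a b \<le> t" "t \<le> max a b"
  shows "t \<in> D"
  using assms int_interval_convex[of D a b t] int_interval_convex[of D b a t]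
  by (auto simp: min_def max_def split: if_splits)

text \<open>Hides the extended endpoints: later arguments see a box only as a product of
  intervals.\<close>

lemma int_box_iff:
  "int_box n S \<longleftrightarrow> (\<exists>D. (\<forall>i\<in>{1..n}. int_interval (D i)) \<and> S = {x \<in> Zn n. \<forall>i\<in>{1..n}. x i \<in> D i})"
  (is "?L \<longleftrightarrow> ?R")
proof
  assume ?L
  then obtain a b where "\<forall>i\<in>{1..n}. bounds (a i) (b i)"
    "S = {x \<in> Zn n. \<forall>i\<in>{1..n}. a i \<le> Fin (x i) \<and> Fin (x i) \<le> b i}"
    unfolding int_box_def by blast
  then show ?R
    by (intro exI[of _ "\<lambda>i. {t. a i \<le> Fin t \<and> Fin t \<le> b i}"]) (auto simp: int_interval_def)
next
  assume ?R
  then obtain D where D: "\<forall>i\<in>{1..n}. int_interval (D i)"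
    "S = {x \<in> Zn n. \<forall>i\<in>{1..n}. x i \<in> D i}" by blast
  then have "\<forall>i\<in>{1..n}. \<exists>p. bounds (fst p) (snd p) \<and> D i = {t. fst p \<le> Fin t \<and> Fin t \<le> snd p}"
    unfolding int_interval_def by (metis fst_conv snd_conv)
  from bchoice[OF this] obtain p where p:
    "\<And>i. i \<in> {1..n} \<Longrightarrow> bounds (fst (p i)) (snd (p i))"
    "\<And>i. i \<in> {1..n} \<Longrightarrow> D i = {t. fst (p i) \<le> Fin t \<and> Fin t \<le> snd (p i)}"
    by blast
  have "S = {x \<in> Zn n. \<forall>i\<in>{1..n}. fst (p i) \<le> Fin (x i) \<and> Fin (x i) \<le> snd (p i)}"
    unfolding D(2) using p(2) by blast
  with p(1) show ?L
    unfolding int_box_def by (intro exI[of _ "fst \<circ> p"] exI[of _ "snd \<circ> p"]) simp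
qed

text \<open>The intervals are the projections of \<open>S\<close>. A point with all coordinates in
  them is reached from any member by overwriting one coordinate after another with
  \<open>exchange\<close>.\<close>

lemma diff_lattice_Lnat_int_box:
  assumes S: "diff_lattice n S" "Lnat_convex_set n S" "S \<subseteq> Zn n"
  shows "int_box n S"
proof -
  define D where "D i = (\<lambda>x. x i) ` S" for i
  have ne: "S \<noteq> {}" using S by (simp add: Lnat_convex_set_def)
  have "int_interval (D i)" if i: "i \<in> {1..n}" for i
  proof (rule int_intervalI)
    fix a b t assume "a \<in> D i" "b \<in> D i" "a \<le> t" "t \<le> b"
    then obtain x y where "x \<in> S" "y \<in> S" "x i \<le> t" "t \<le> y i" by (auto simp: D_def)
    then have "x(i := t) \<in> S" using exchange[OF S] i by blast
    then show "t \<in> D i" unfolding D_def by (intro image_eqI[of _ _ "x(i := t)"]) simp_all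
  qed (use ne in \<open>simp add: D_def\<close>)
  moreover have "x \<in> S" if x: "x \<in> Zn n" "\<forall>i\<in>{1..n}. x i \<in> D i" for x
  proof -
    have "\<exists>y\<in>S. \<forall>i\<in>{1..k}. y i = x i" if "k \<le> n" for k
      using that
    proof (induction k)
      case 0
      then show ?case using ne by auto
    next
      case (Suc k)
      then obtain y where y: "y \<in> S" "\<forall>i\<in>{1..k}. y i = x i" by auto
      have "x (Suc k) \<in> D (Suc k)" using Suc.prems x(2) by simp
      then obtain z where z: "z \<in> S" "z (Suc k) = x (Suc k)" unfolding D_def by auto
      have "y(Suc k := x (Suc k)) \<in> S"
        using Suc.prems z by (intro exchange[OF S y(1) z(1)]) auto
      then show ?case using y by (intro bexI[of _ "y(Suc k := x (Suc k))"]) auto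
    qed
    then obtain y where "y \<in> S" "\<forall>i\<in>{1..n}. y i = x i" by blast
    moreover from this have "y = x"
      using S(3) x(1) by (intro int_vecs_eqI[of _ "{1..n}"]) auto
    ultimately show ?thesis by simp
  qed
  moreover have "x i \<in> D i" if "x \<in> S" for x i
    using that by (simp add: D_def)
  ultimately have "S = {x \<in> Zn n. \<forall>i\<in>{1..n}. x i \<in> D i}" "\<forall>i\<in>{1..n}. int_interval (D i)"
    using S(3) by blast+
  then show ?thesis
    unfolding int_box_iff by blast
qed

section \<open>From boxes and separable functions to both properties\<close>

text \<open>If the same function is the larger one at \<open>i - 1\<close> and \<open>i\<close>, the
  two increments are at most swapped. If the order switches, both mixed increments lie between the
  original ones.\<close>

lemma increments_max_min:
  assumes "i \<in> {1..n}"
  shows "increments n (\<lambda>k. max (g k) (h k)) i + increments n (\<lambda>k. min (g k) (h k)) i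
      = increments n g i + increments n h i"
    and "min (increments n g i) (increments n h i) \<le> increments n (\<lambda>k. max (g k) (h k)) i"
    and "increments n (\<lambda>k. max (g k) (h k)) i \<le> max (increments n g i) (increments n h i)"
    and "min (increments n g i) (increments n h i) \<le> increments n (\<lambda>k. min (g k) (h k)) i"
    and "increments n (\<lambda>k. min (g k) (h k)) i \<le> max (increments n g i) (increments n h i)"
  using assms by (auto simp: increments_def max_def min_def)

lemma mid_up_down:
  assumes "i \<in> I"
  shows "mid_up I x y i + mid_down I x y i = x i + y i"
    and "min (x i) (y i) \<le> mid_up I x y i" and "mid_up I x y i \<le> max (x i) (y i)"
    and "min (x i) (y i) \<le> mid_down I x y i" and "mid_down I x y i \<le> max (x i) (y i)"
  using assms by (simp_all add: mid_up_eq mid_down_eq; linarith)+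

lemma int_box_diff_lattice:
  assumes "int_box n S"
  shows "S \<noteq> {}" "diff_lattice n S" "Lnat_convex_set n S"
proof -
  obtain D where D: "\<And>i. i \<in> {1..n} \<Longrightarrow> int_interval (D i)"
    and S: "S = {x \<in> Zn n. \<forall>i\<in>{1..n}. x i \<in> D i}"
    using assms unfolding int_box_iff by blast
  have "\<exists>t. t \<in> D i" if "i \<in> {1..n}" for i
  proof -
    have "int_interval (D i)" using D that by blast
    then obtain a b where "bounds a b" "D i = {t. a \<le> Fin t \<and> Fin t \<le> b}"
      unfolding int_interval_def by blast
    then show ?thesis
      by (cases a; cases b) (auto simp: bounds_def)
  qed
  then obtain d where "\<And>i. i \<in> {1..n} \<Longrightarrow> d i \<in> D i" by metis
  then have "restrict d {1..n} \<in> S" by (simp add: S)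
  then show ne: "S \<noteq> {}" by auto
  show "diff_lattice n S"
    unfolding diff_lattice_def S
    using int_interval_between[OF D _ _ increments_max_min(2,3)]
      int_interval_between[OF D _ _ increments_max_min(4,5)] by simp
  show "Lnat_convex_set n S"
    unfolding Lnat_convex_set_def
    using ne int_interval_between[OF D _ _ mid_up_down(2,3)]
      int_interval_between[OF D _ _ mid_up_down(4,5)] by (simp add: S)
qed

text \<open>Local convexity makes forward differences nondecreasing, so a step inwards at the left
  end adds at most what the step inwards at the right end removes.\<close>

lemma convex_seq_inner_le:
  fixes g :: "int \<Rightarrow> real"
  assumes conv: "\<And>t. a < t \<Longrightarrow> t < b \<Longrightarrow> 2 * g t \<le> g (t - 1) + g (t + 1)"
    and "a + 2 * int k \<le> b"
  shows "g (a + int k) + g (b - int k) \<le> g a + g b"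
  using assms(2)
proof (induction k)
  case 0
  then show ?case by simp
next
  case (Suc k)
  have slope: "a \<le> s \<Longrightarrow> s + int m < b \<Longrightarrow> g (s + 1) - g s \<le> g (s + int m + 1) - g (s + int m)" for s m
  proof (induction m)
    case 0
    then show ?case by simp
  next
    case (Suc m)
    then show ?case using conv[of "s + int m + 1"] by (simp add: algebra_simps)
  qed
  have "g (a + int k + 1) - g (a + int k) \<le> g (b - int k) - g (b - int k - 1)"
    \<comment> \<open>The distance is chosen so that the later difference is the one ending at
      \<open>b - int k\<close>.\<close>
    using slope[of "a + int k" "nat (b - int k - 1 - (a + int k))"] Suc.prems
    by (simp add: algebra_simps)
  then show ?case using Suc by (simp add: algebra_simps)
qed

text \<open>Common core of both converse directions. If \<open>\<phi>\<close> is finite at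
  \<open>a\<close> and \<open>b\<close>, its interval domain makes it real between them, and
  \<open>convex_seq_inner_le\<close> applies.\<close>

lemma univ_convex_inner_le:
  assumes \<phi>: "univ_convex \<phi>" and sum: "c + d = a + b"
    and c: "min a b \<le> c" "c \<le> max a b"
  shows "\<phi> c + \<phi> d \<le> \<phi> a + \<phi> b"
proof -
  have notMInf: "\<phi> t \<noteq> -\<infinity>" and dom: "int_interval (eff_dom UNIV \<phi>)"
    and mid: "2 * \<phi> t \<le> \<phi> (t - 1) + \<phi> (t + 1)" for t
    using \<phi> unfolding univ_convex_def by blast+
  \<comment> \<open>The case of ordered pairs; the others follow by swapping \<open>a\<close> with
    \<open>b\<close> or \<open>c\<close> with \<open>d\<close>.\<close>
  have main: "\<phi> c + \<phi> d \<le> \<phi> a + \<phi> b" if cd: "a \<le> c" "c \<le> d" "c + d = a + b" for a b c d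
  proof (cases "\<phi> a < \<infinity> \<and> \<phi> b < \<infinity>")
    case False
    then show ?thesis by auto
  next
    case True
    define g where "g t = real_of_ereal (\<phi> t)" for t
    have fin: "\<phi> t = ereal (g t)" if "a \<le> t" "t \<le> b" for t
    proof -
      have "t \<in> eff_dom UNIV \<phi>"
        by (rule int_interval_convex[OF dom _ _ that]) (use True in \<open>simp_all add: eff_dom_def\<close>)
      then have "\<phi> t \<noteq> \<infinity>" by (simp add: eff_dom_def)
      then show ?thesis
        unfolding g_def using notMInf[of t] by (cases "\<phi> t") simp_all
    qed
    have conv: "2 * g t \<le> g (t - 1) + g (t + 1)" if "a < t" "t < b" for t
    proof -
      have "2 * ereal (g t) \<le> ereal (g (t - 1)) + ereal (g (t + 1))"
        using mid[of t] fin[of t] fin[of "t - 1"] fin[of "t + 1"] that by simp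
      then show ?thesis by simp
    qed
    have "g (a + int (nat (c - a))) + g (b - int (nat (c - a))) \<le> g a + g b"
      by (rule convex_seq_inner_le[OF conv]) (use cd in simp_all)
    moreover have "a + int (nat (c - a)) = c" "b - int (nat (c - a)) = d"
      using cd by simp_all
    ultimately have "g c + g d \<le> g a + g b" by metis
    moreover have "c \<le> b" "a \<le> d" "d \<le> b" "a \<le> b" using cd by linarith+
    ultimately show ?thesis using cd fin[of a] fin[of b] fin[of c] fin[of d] by simp
  qed
  show ?thesis
  proof (cases "c \<le> d")
    case cd: True
    show ?thesis
    proof (cases "a \<le> b")
      case True
      then show ?thesis using cd c sum by (intro main) linarith+
    next
      case False
      then have "\<phi> c + \<phi> d \<le> \<phi> b + \<phi> a" using cd c sum by (intro main) linarith+
      then show ?thesis by (simp only: add.commute)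
    qed
  next
    case dc: False
    show ?thesis
    proof (cases "a \<le> b")
      case True
      then have "\<phi> d + \<phi> c \<le> \<phi> a + \<phi> b" using dc c sum by (intro main) linarith+
      then show ?thesis by (simp only: add.commute)
    next
      case False
      then have "\<phi> d + \<phi> c \<le> \<phi> b + \<phi> a" using dc c sum by (intro main) linarith+
      then show ?thesis by (simp only: add.commute)
    qed
  qed
qed

lemma separable_convex_imp:
  assumes "separable_convex n f"
  shows "multimodular n f" "Lnat_convex n f"
proof -
  obtain \<phi> where \<phi>: "\<And>i. i \<in> {1..n} \<Longrightarrow> univ_convex (\<phi> i)"
    and f: "\<And>x. x \<in> Zn n \<Longrightarrow> f x = (\<Sum>i=1..n. \<phi> i (x i))"
    using assms unfolding separable_convex_def by blast
  have le: "f z + f w \<le> f x + f y"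
    if "x \<in> Zn n" "y \<in> Zn n" "z \<in> Zn n" "w \<in> Zn n"
      and "\<And>i. i \<in> {1..n} \<Longrightarrow> z i + w i = x i + y i"
      and "\<And>i. i \<in> {1..n} \<Longrightarrow> min (x i) (y i) \<le> z i"
      and "\<And>i. i \<in> {1..n} \<Longrightarrow> z i \<le> max (x i) (y i)" for x y z w
    using that by (simp add: f flip: sum.distrib) (intro sum_mono univ_convex_inner_le \<phi>; simp)
  show "multimodular n f"
    unfolding multimodular_iff by (intro allI le increments_max_min) simp_all
  show "Lnat_convex n f"
    unfolding Lnat_convex_def by (intro ballI le mid_up_down) simp_all
qed

section \<open>Vanishing mixed differences and separation of variables\<close>

lemma square_eq_less:
  assumes f: "multimodular n f" "Lnat_convex n f" and z: "z \<in> Zn n"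
    and ij: "i \<in> {1..n}" "j \<in> {1..n}" "i < j"
  shows "f z + f (z(i := z i + 1, j := z j + 1)) = f (z(i := z i + 1)) + f (z(j := z j + 1))"
proof (rule antisym)
  let ?u = "z(i := z i + 1)" and ?v = "z(j := z j + 1)" and ?w = "z(i := z i + 1, j := z j + 1)"
  have uv: "?u \<in> Zn n" "?v \<in> Zn n" "?w \<in> Zn n" using z ij by auto
  have "f (mid_up {1..n} ?u ?v) + f (mid_down {1..n} ?u ?v) \<le> f ?u + f ?v"
    using f(2) uv unfolding Lnat_convex_def by blast
  moreover have "mid_up {1..n} ?u ?v = ?w" "mid_down {1..n} ?u ?v = z"
    using uv z ij by (auto intro!: int_vecs_eqI[of _ "{1..n}"] simp: mid_up_eq mid_down_eq)
  ultimately show "f z + f ?w \<le> f ?u + f ?v" by (simp add: add.commute)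
  \<comment> \<open>These are prefix sums of \<open>?w\<close> and, raised by 1, of
    \<open>z\<close>. They agree for \<open>i \<le> k < j\<close>, \<open>h\<close> is larger before
    \<open>i\<close> and \<open>g\<close> from \<open>j\<close> on, so max and min recombine into
    prefix sums of \<open>?v\<close> (raised by 1) and \<open>?u\<close>.\<close>
  define g where "g k = psum z k + (if i \<le> k then 1 else 0) + (if j \<le> k then 1 else 0)" for k
  define h where "h k = psum z k + 1" for k
  have *: "increments n (\<lambda>k. max (g k) (h k)) = increments n (\<lambda>k. psum z k + (if j \<le> k then 1 else 0) + 1)"
    "increments n (\<lambda>k. min (g k) (h k)) = increments n (\<lambda>k. psum z k + (if i \<le> k then 1 else 0))"
    by (rule increments_cong, use ij in \<open>auto simp: g_def h_def\<close>)+
  have **: "increments n g = ?w" "increments n h = z"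
  proof -
    have "g k - g (k - 1) = ?w k" if "k \<in> {1..n}" for k
      using that ij psum_step[of k z] by (auto simp: g_def)
    then show "increments n g = ?w"
      using uv by (intro int_vecs_eqI[of _ "{1..n}"]) (auto simp: increments_def)
    show "increments n h = z" using z by (simp add: h_def[abs_def] increments_psum)
  qed
  have "f (increments n (\<lambda>k. max (g k) (h k))) + f (increments n (\<lambda>k. min (g k) (h k)))
      \<le> f (increments n g) + f (increments n h)"
    using f(1) unfolding multimodular_iff by blast
  then show "f ?u + f ?v \<le> f z + f ?w"
    unfolding * ** increments_shift increments_psum_upd[OF z ij(1)] increments_psum_upd[OF z ij(2)]
    by (simp add: add.commute)
qed

lemma square_eq_pos:
  assumes "multimodular n f" "Lnat_convex n f" "z \<in> Zn n"
    and "i \<in> {1..n}" "j \<in> {1..n}" "i \<noteq> j"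
  shows "f z + f (z(i := z i + 1, j := z j + 1)) = f (z(i := z i + 1)) + f (z(j := z j + 1))"
proof (cases "i < j")
  case True
  then show ?thesis using square_eq_less assms by blast
next
  case False
  then show ?thesis using square_eq_less[of n f z j i] assms
    by (simp add: add.commute fun_upd_twist)
qed

text \<open>The equation compares the two diagonals of a unit square, so it can be read off at the
  lowest corner, where both steps are positive.\<close>

lemma square_eq:
  assumes f: "multimodular n f" "Lnat_convex n f" and z: "z \<in> Zn n"
    and ij: "i \<in> {1..n}" "j \<in> {1..n}" "i \<noteq> j"
    and ab: "\<bar>a - z i\<bar> = 1" "\<bar>b - z j\<bar> = 1"
  shows "f z + f (z(i := a, j := b)) = f (z(i := a)) + f (z(j := b))"
proof -
  define l where "l = z(i := min a (z i), j := min b (z j))"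
  have "l \<in> Zn n" using z ij by (simp add: l_def)
  from square_eq_pos[OF f this ij]
  have eq: "f l + f (l(i := l i + 1, j := l j + 1)) = f (l(i := l i + 1)) + f (l(j := l j + 1))" .
  consider "a = z i + 1" "b = z j + 1" | "a = z i + 1" "b = z j - 1"
    | "a = z i - 1" "b = z j + 1" | "a = z i - 1" "b = z j - 1"
    using ab by linarith
  then show ?thesis
    using eq ij(3) by cases (simp_all add: l_def fun_upd_twist add.commute)
qed

lemma multimodular_Lnat_separable:
  assumes n: "n \<ge> 1" and p: "proper_on (Zn n) f" and f: "multimodular n f" "Lnat_convex n f"
  shows "separable_convex n f"
proof -
  define S where "S = eff_dom (Zn n) f"
  have "int_box n S"
    unfolding S_def
    by (intro diff_lattice_Lnat_int_box diff_lattice_eff_dom Lnat_convex_set_eff_dom p f)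
      (auto simp: eff_dom_def)
  then obtain D where D: "\<And>i. i \<in> {1..n} \<Longrightarrow> int_interval (D i)"
    and S: "S = {x \<in> Zn n. \<forall>i\<in>{1..n}. x i \<in> D i}"
    unfolding int_box_iff by blast
  obtain w where w: "w \<in> S" using p by (auto simp: proper_on_def S_def)
  then have wZ: "w \<in> Zn n" by (simp add: S)
  define r where "r x = real_of_ereal (f x)" for x
  have r: "f x = ereal (r x)" if "x \<in> S" for x
    using that p by (cases "f x") (auto simp: r_def S_def eff_dom_def proper_on_def)
  have inf: "f x = \<infinity>" if "x \<in> Zn n" "x \<notin> S" for x
    using that by (auto simp: S_def eff_dom_def)
  have wS: "w(i := t) \<in> S \<longleftrightarrow> t \<in> D i" if "i \<in> {1..n}" for i t
    using w that by (auto simp: S)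
  \<comment> \<open>The gap between \<open>f\<close> and the sum of its changes along the axis lines
    through \<open>w\<close>. Separability on \<open>S\<close> amounts to \<open>F\<close> being
    constant there.\<close>
  define F where "F x = r x - (\<Sum>k=1..n. r (w(k := x k)) - r w)" for x
  have F: "F x = r w" if "x \<in> S" for x
    using that
  proof (induction "\<Sum>k=1..n. nat \<bar>x k - w k\<bar>" arbitrary: x rule: less_induct)
    case less
    have xZ: "x \<in> Zn n" and xD: "\<And>k. k \<in> {1..n} \<Longrightarrow> x k \<in> D k" using less.prems by (auto simp: S)
    have wD: "w k \<in> D k" if "k \<in> {1..n}" for k using w that by (auto simp: S)
    show ?case
    proof (cases "\<exists>i\<in>{1..n}. \<exists>j\<in>{1..n}. i \<noteq> j \<and> x i \<noteq> w i \<and> x j \<noteq> w j")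
      case False
      have "\<exists>i\<in>{1..n}. \<forall>k\<in>{1..n}. k \<noteq> i \<longrightarrow> x k = w k"
      proof (cases "\<exists>i\<in>{1..n}. x i \<noteq> w i")
        case True
        with False show ?thesis by blast
      next
        case False
        \<comment> \<open>Here \<open>x\<close> agrees with \<open>w\<close> in every coordinate and
          any index serves; \<open>n \<ge> 1\<close> provides the index 1.\<close>
        then show ?thesis using n by (intro bexI[of _ 1]) auto
      qed
      then obtain i where i: "i \<in> {1..n}" "\<And>k. k \<in> {1..n} \<Longrightarrow> k \<noteq> i \<Longrightarrow> x k = w k"
        by blast
      have "w(i := x i) = x"
        using i xZ wZ by (intro int_vecs_eqI[of _ "{1..n}"]) auto
      moreover have "(\<Sum>k=1..n. r (w(k := x k)) - r w) = r (w(i := x i)) - r w"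
        using i by (subst sum.remove[of _ i]) (auto intro!: sum.neutral)
      ultimately show ?thesis by (simp add: F_def)
    next
      case True
      then obtain i j where ij: "i \<in> {1..n}" "j \<in> {1..n}" "i \<noteq> j" "x i \<noteq> w i" "x j \<noteq> w j"
        by blast
      \<comment> \<open>One step towards \<open>w\<close> in each of two differing coordinates: the
        other three corners of the square stay in the box and are closer to \<open>w\<close>, so the
        induction hypothesis covers them.\<close>
      define a where "a = x i - sgn (x i - w i)"
      define b where "b = x j - sgn (x j - w j)"
      have a: "\<bar>a - x i\<bar> = 1" "\<bar>a - w i\<bar> < \<bar>x i - w i\<bar>" "min (w i) (x i) \<le> a" "a \<le> max (w i) (x i)"
        using ij by (auto simp: a_def sgn_if)
      have b: "\<bar>b - x j\<bar> = 1" "\<bar>b - w j\<bar> < \<bar>x j - w j\<bar>" "min (w j) (x j) \<le> b" "b \<le> max (w j) (x j)"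
        using ij by (auto simp: b_def sgn_if)
      have "a \<in> D i" "b \<in> D j"
        using int_interval_between[OF D[OF ij(1)] wD[OF ij(1)] xD[OF ij(1)] a(3,4)]
          int_interval_between[OF D[OF ij(2)] wD[OF ij(2)] xD[OF ij(2)] b(3,4)] by simp_all
      then have S3: "x(i := a) \<in> S" "x(j := b) \<in> S" "x(i := a, j := b) \<in> S"
        using less.prems ij by (auto simp: S)
      have dist: "(\<Sum>k=1..n. nat \<bar>y k - w k\<bar>) < (\<Sum>k=1..n. nat \<bar>x k - w k\<bar>)"
        if "y \<in> {x(i := a), x(j := b), x(i := a, j := b)}" for y
      proof (rule sum_strict_mono_ex1)
        have y: "y k = x k \<or> k = i \<and> y k = a \<or> k = j \<and> y k = b" for k
          using that by (cases "k = i"; cases "k = j") auto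
        show "\<forall>k\<in>{1..n}. nat \<bar>y k - w k\<bar> \<le> nat \<bar>x k - w k\<bar>"
          using y a(2) b(2) by (metis nat_mono order.refl order.strict_implies_order)
        have "y i = a \<or> y j = b" using that by auto
        then show "\<exists>k\<in>{1..n}. nat \<bar>y k - w k\<bar> < nat \<bar>x k - w k\<bar>"
          using ij(1,2) a(2) b(2) by (metis abs_ge_zero nat_less_eq_zless)
      qed simp
      have F3: "F (x(i := a)) = r w" "F (x(j := b)) = r w" "F (x(i := a, j := b)) = r w"
        using less.hyps dist S3 by blast+
      have "r x + r (x(i := a, j := b)) = r (x(i := a)) + r (x(j := b))"
        using square_eq[OF f xZ ij(1-3) a(1) b(1)] r S3 less.prems by simp
      moreover have "(\<Sum>k=1..n. r (w(k := x k)) - r w) + (\<Sum>k=1..n. r (w(k := (x(i := a, j := b)) k)) - r w)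
          = (\<Sum>k=1..n. r (w(k := (x(i := a)) k)) - r w) + (\<Sum>k=1..n. r (w(k := (x(j := b)) k)) - r w)"
        unfolding sum.distrib[symmetric]
      proof (rule sum.cong)
        fix k
        show "(r (w(k := x k)) - r w) + (r (w(k := (x(i := a, j := b)) k)) - r w)
            = (r (w(k := (x(i := a)) k)) - r w) + (r (w(k := (x(j := b)) k)) - r w)"
          using ij(3) by (cases "k = i"; cases "k = j") simp_all
      qed simp
      ultimately have "F x + F (x(i := a, j := b)) = F (x(i := a)) + F (x(j := b))"
        unfolding F_def by linarith
      then show ?thesis using F3 by simp
    qed
  qed
  \<comment> \<open>The constant \<open>r w\<close> must enter only once in total, so it is shared
    equally among the \<open>n\<close> summands.\<close>
  define c where "c = r w / n - r w"
  define \<phi> where "\<phi> i t = f (w(i := t)) + ereal c" for i t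
  have notMInf: "\<phi> i t \<noteq> -\<infinity>" if "i \<in> {1..n}" for i t
    using p wZ that by (cases "f (w(i := t))") (auto simp: \<phi>_def proper_on_def)
  have "univ_convex (\<phi> i)" if i: "i \<in> {1..n}" for i
    unfolding univ_convex_def
  proof (intro conjI allI notMInf[OF i])
    have "eff_dom UNIV (\<phi> i) = D i"
    proof -
      have "\<phi> i t < \<infinity> \<longleftrightarrow> t \<in> D i" for t
        using wS[OF i, of t] r[of "w(i := t)"] inf[of "w(i := t)"] wZ i
        by (cases "t \<in> D i") (auto simp: \<phi>_def)
      then show ?thesis by (auto simp: eff_dom_def)
    qed
    then show "int_interval (eff_dom UNIV (\<phi> i))" using D i by simp
    fix t
    let ?u = "w(i := t - 1)" and ?v = "w(i := t + 1)"
    have uv: "?u \<in> Zn n" "?v \<in> Zn n" "w(i := t) \<in> Zn n" using wZ i by auto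
    have "f (mid_up {1..n} ?u ?v) + f (mid_down {1..n} ?u ?v) \<le> f ?u + f ?v"
      using f(2) uv unfolding Lnat_convex_def by blast
    \<comment> \<open>The coordinate sums are even, so nothing is rounded and both midpoints
      coincide; midpoint convexity becomes univariate convexity.\<close>
    moreover have "mid_up {1..n} ?u ?v = w(i := t)" "mid_down {1..n} ?u ?v = w(i := t)"
      by (rule int_vecs_eqI[OF _ uv(3)]; simp add: mid_up_eq mid_down_eq)+
    ultimately have "f (w(i := t)) + f (w(i := t)) \<le> f ?u + f ?v" by simp
    then show "2 * \<phi> i t \<le> \<phi> i (t - 1) + \<phi> i (t + 1)"
      unfolding \<phi>_def
      by (cases "f (w(i := t))"; cases "f ?u"; cases "f ?v") simp_all
  qed
  moreover have "f x = (\<Sum>i=1..n. \<phi> i (x i))" if x: "x \<in> Zn n" for x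
  proof (cases "x \<in> S")
    case True
    then have "\<phi> i (x i) = ereal (r (w(i := x i)) + c)" if "i \<in> {1..n}" for i
      using that wS[OF that, of "x i"] r by (simp add: \<phi>_def S)
    then have "(\<Sum>i=1..n. \<phi> i (x i)) = (\<Sum>i=1..n. ereal (r (w(i := x i)) + c))"
      by (intro sum.cong) simp_all
    also have "\<dots> = ereal (\<Sum>i=1..n. r (w(i := x i)) + c)"
      by (rule sum_ereal)
    also have "(\<Sum>i=1..n. r (w(i := x i)) + c) = (\<Sum>i=1..n. r (w(i := x i)) - r w) + r w"
    proof -
      have "real n * c = r w - real n * r w"
        using n by (simp add: c_def right_diff_distrib)
      then show ?thesis by (simp add: sum.distrib sum_subtractf)
    qed
    also have "\<dots> = r x" using F[OF True] by (simp add: F_def)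
    finally show ?thesis using r[OF True] by simp
  next
    case False
    then obtain i where i: "i \<in> {1..n}" "x i \<notin> D i" using x by (auto simp: S)
    then have "\<phi> i (x i) = \<infinity>"
      using inf[of "w(i := x i)"] wS[of i "x i"] wZ by (simp add: \<phi>_def)
    then have "(\<Sum>i=1..n. \<phi> i (x i)) = \<infinity>"
      using i(1) by (auto simp: sum_Pinfty)
    then show ?thesis using inf[OF x False] by simp
  qed
  ultimately show ?thesis unfolding separable_convex_def by blast
qed

theorem theorem5p10:
  fixes n :: nat
  assumes "n \<ge> 1"
  shows "(\<forall>S. S \<subseteq> Zn n \<longrightarrow>
            (int_box n S \<longleftrightarrow> multimodular_set n S \<and> Lnat_convex_set n S)) \<and>
         (\<forall>f. proper_on (Zn n) f \<longrightarrow>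
            (separable_convex n f \<longleftrightarrow> multimodular n f \<and> Lnat_convex n f))"
proof (intro conjI allI impI)
  fix S assume S: "S \<subseteq> Zn n"
  show "int_box n S \<longleftrightarrow> multimodular_set n S \<and> Lnat_convex_set n S"
  proof
    assume "int_box n S"
    from int_box_diff_lattice[OF this] show "multimodular_set n S \<and> Lnat_convex_set n S"
      unfolding multimodular_set_def using diff_lattice_multimodular_delta by blast
  next
    assume "multimodular_set n S \<and> Lnat_convex_set n S"
    then show "int_box n S"
      using multimodular_set_diff_lattice diff_lattice_Lnat_int_box S by blast
  qed
next
  fix f assume "proper_on (Zn n) f"
  from multimodular_Lnat_separable[OF assms this] separable_convex_imp[of n f]
  show "separable_convex n f \<longleftrightarrow> multimodular n f \<and> Lnat_convex n f" by blast
qed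

end
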